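(* Let $p,q\ge 1$ be integers, let $k_0\in\{1,\ldots,p\}$, and let $F\in\mathbf H_2^{p\times q}$. Then there exist a point $w_0\in\mathbb D$ and an orthogonal projection $P_0\in\mathbb C^{p\times p}$ of rank $k_0$ such that $$(1-|w_0|^2)\,\mathrm{Tr}\,[P_0F(w_0),F(w_0)]=(1-|w_0|^2)\,\mathrm{Tr}\big(F(w_0)^*P_0F(w_0)\big)$$ is maximum, i.e. for every $w\in\mathbb D$ and every orthogonal projection $P\in\mathbb C^{p\times p}$ of rank $k_0$, $$(1-|w|^2)\,\mathrm{Tr}\big(F(w)^*PF(w)\big)\le (1-|w_0|^2)\,\mathrm{Tr}\big(F(w_0)^*P_0F(w_0)\big).$$
   Context: $\mathbb D$ is the open unit disc in $\mathbb C$. $\mathbf H_2^{p\times q}$ is the space of $p\times q$ matrices with entries in the Hardy space $\mathbf H_2(\mathbb D)$; equivalently, the functions $F(z)=\sum_{n\ge0}F_nz^n$ with $F_n\in\mathbb C^{p\times q}$ and $\sum_{n\ge0}\mathrm{Tr}(F_n^*F_n)<\infty$. For $F,G\in\mathbf H_2^{p\times q}$ with coefficients $F_n,G_n$, $[F,G]=\sum_{n\ge0}G_n^*F_n\in\mathbb C^{q\times q}$; in particular, for constant matrices $A,B\in\mathbb C^{p\times q}$, $[A,B]=B^*A$. An orthogonal projection is a matrix $P\in\mathbb C^{p\times p}$ with $P=P^2=P^*$. *)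

theory Defs
  imports "HOL-Analysis.Analysis"
begin

text \<open>A $p \times q$ complex matrix is an element of \<^typ>\<open>complex ^ 'q ^ 'p\<close>, and the matrix product
  is \<open>**\<close> (the operation \<open>*\<close> on this type is the entrywise product).\<close>

definition ctranspose :: "complex ^ 'n ^ 'm \<Rightarrow> complex ^ 'm ^ 'n" where
  "ctranspose A = map_matrix cnj (transpose A)"

text \<open>The matrix-valued form $[A, B] = B^* A$ on constant matrices.\<close>

definition mat_form :: "complex ^ 'q ^ 'p \<Rightarrow> complex ^ 'q ^ 'p \<Rightarrow> complex ^ 'q ^ 'q" where
  "mat_form A B = ctranspose B ** A"

definition orthogonal_projection :: "complex ^ 'p ^ 'p \<Rightarrow> bool" where
  "orthogonal_projection P \<longleftrightarrow> P ** P = P \<and> ctranspose P = P"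

text \<open>Elements of the matrix Hardy space are represented by total functions; only the values on the
  open unit disc are constrained, and those outside are irrelevant. The term
  \<open>map_matrix ((*) (z ^ n)) (c n)\<close> is $z^n F_n$, since the scalar multiplication \<open>*\<^sub>R\<close> only
  takes real scalars. The traces are nonnegative reals, as they are the sums of the squared moduli
  of the entries, so summability of the complex series says exactly that the sum is finite.\<close>

definition hardy2 :: "(complex \<Rightarrow> complex ^ 'q ^ 'p) set" where
  "hardy2 = {F. \<exists>c :: nat \<Rightarrow> complex ^ 'q ^ 'p.
     (\<forall>z\<in>ball 0 1. (\<lambda>n. map_matrix ((*) (z ^ n)) (c n)) sums F z) \<and>
     summable (\<lambda>n. trace (ctranspose (c n) ** c n))}"

text \<open>The traces being maximised are real, so taking their real part loses nothing.\<close>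

lemma trace_ctranspose: "trace (ctranspose A) = cnj (trace A)"
  by (simp add: trace_def ctranspose_def transpose_def map_matrix_def)

lemma ctranspose_mult: "ctranspose (A ** B) = ctranspose B ** ctranspose A"
  by (simp add: ctranspose_def transpose_def map_matrix_def matrix_matrix_mult_def vec_eq_iff
      mult.commute)

lemma ctranspose_ctranspose: "ctranspose (ctranspose A) = A"
  by (simp add: ctranspose_def transpose_def map_matrix_def vec_eq_iff)

lemma trace_compression_real:
  assumes "orthogonal_projection P"
  shows "trace (ctranspose A ** P ** A) \<in> \<real>"
proof -
  have "ctranspose (ctranspose A ** P ** A) = ctranspose A ** P ** A"
    using assms
    by (simp add: orthogonal_projection_def ctranspose_mult ctranspose_ctranspose matrix_mul_assoc)
  then show ?thesis
    by (metis trace_ctranspose Reals_cnj_iff)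
qed

end

theory Submission
  imports Defs
begin

text \<open>For an orthogonal projection \<open>P\<close> the quantity to be maximised is
  $(1 - |w|^2) \|P F(w)\|^2$ with the Frobenius norm. It lies between \<open>0\<close> and $(1 - |w|^2) \|F(w)\|^2$,
  which tends to \<open>0\<close> at the unit circle: this is clear for polynomials, and the tail of the power
  series is controlled by Cauchy--Schwarz. The projections of rank \<open>k0\<close> form a nonempty compact
  set, because the rank is locally constant on idempotent matrices. So either the quantity
  vanishes identically, or its supremum is the one over a compact set, where it is attained.\<close>

section \<open>Decay at the boundary\<close>

text \<open>Each product is at most the sum of the two squares, so a square-summable series plus a
  geometric series in \<open>r\<^sup>2\<close> is a majorant.\<close>

lemma summable_mult_power_of_square_summable:
  fixes b :: "nat \<Rightarrow> real"
  assumes "summable (\<lambda>n. (b n)\<^sup>2)" and "\<bar>r\<bar> < 1"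
  shows "summable (\<lambda>n. b n * r ^ n)"
proof (rule summable_comparison_test')
  have "\<bar>r\<^sup>2\<bar> < 1"
    using assms(2) by (simp add: abs_square_less_1)
  then show "summable (\<lambda>n. (b n)\<^sup>2 + (r\<^sup>2) ^ n)"
    using assms(1) by (intro summable_add summable_geometric) auto
  show "norm (b n * r ^ n) \<le> (b n)\<^sup>2 + (r\<^sup>2) ^ n" for n
  proof -
    have "0 \<le> (\<bar>b n\<bar> - \<bar>r ^ n\<bar>)\<^sup>2" "0 \<le> \<bar>b n\<bar> * \<bar>r ^ n\<bar>"
      by auto
    then have "\<bar>b n\<bar> * \<bar>r ^ n\<bar> \<le> \<bar>b n\<bar>\<^sup>2 + \<bar>r ^ n\<bar>\<^sup>2"
      unfolding power2_diff by linarith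
    then show ?thesis
      by (simp add: abs_mult power_mult[symmetric] mult.commute)
  qed
qed

text \<open>Cauchy-Schwarz against the powers of \<open>r\<close>, whose squares sum to at most
  \<open>1 / (1 - r\<^sup>2)\<close>, bounds every partial sum. The weight cancels this factor, so
  the bound is uniform in \<open>r\<close>.\<close>

lemma power_series_square_le:
  fixes b :: "nat \<Rightarrow> real"
  assumes "summable (\<lambda>n. (b n)\<^sup>2)" and "\<bar>r\<bar> < 1"
  shows "(1 - r\<^sup>2) * (\<Sum>n. b n * r ^ n)\<^sup>2 \<le> (\<Sum>n. (b n)\<^sup>2)"
proof -
  have r2: "r\<^sup>2 < 1"
    using assms(2) by (simp add: abs_square_less_1)
  have fin: "(\<Sum>n<N. b n * r ^ n)\<^sup>2 \<le> (\<Sum>n. (b n)\<^sup>2) * (1 / (1 - r\<^sup>2))" for N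
  proof -
    have "(\<Sum>n<N. b n * r ^ n)\<^sup>2 \<le> (\<Sum>n<N. (b n)\<^sup>2) * (\<Sum>n<N. (r ^ n)\<^sup>2)"
      by (rule Cauchy_Schwarz_ineq_sum)
    also have "(\<Sum>n<N. (b n)\<^sup>2) \<le> (\<Sum>n. (b n)\<^sup>2)"
      by (intro sum_le_suminf assms) auto
    also have "(\<Sum>n<N. (r ^ n)\<^sup>2) = (\<Sum>n<N. (r\<^sup>2) ^ n)"
      by (simp add: power_mult[symmetric] mult.commute)
    also have "\<dots> \<le> (\<Sum>n. (r\<^sup>2) ^ n)"
      using r2 by (intro sum_le_suminf summable_geometric) auto
    also have "\<dots> = 1 / (1 - r\<^sup>2)"
      using r2 by (intro suminf_geometric) auto
    finally show ?thesis
      using assms(1) by (simp add: mult_left_mono mult_right_mono sum_nonneg suminf_nonneg)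
  qed
  have "(\<lambda>N. (\<Sum>n<N. b n * r ^ n)\<^sup>2) \<longlonglongrightarrow> (\<Sum>n. b n * r ^ n)\<^sup>2"
    by (intro tendsto_power summable_LIMSEQ summable_mult_power_of_square_summable assms)
  then have "(\<Sum>n. b n * r ^ n)\<^sup>2 \<le> (\<Sum>n. (b n)\<^sup>2) * (1 / (1 - r\<^sup>2))"
    using fin by (intro LIMSEQ_le_const2) auto
  then show ?thesis
    using r2 by (simp add: field_simps)
qed

text \<open>The series is split at a fixed index \<open>N\<close>. The weighted tail is small
  uniformly in \<open>r\<close> by the preceding bound, and the remaining polynomial is continuous
  at 1, where the weight vanishes.\<close>

lemma power_series_square_decay:
  fixes b :: "nat \<Rightarrow> real"
  assumes "summable (\<lambda>n. (b n)\<^sup>2)"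
  shows "((\<lambda>r. (1 - r\<^sup>2) * (\<Sum>n. b n * r ^ n)\<^sup>2) \<longlongrightarrow> 0) (at_left 1)"
proof (rule order_tendstoI)
  fix e :: real assume "0 < e"
  have "(\<lambda>N. (\<Sum>n. (b (n + N))\<^sup>2)) \<longlonglongrightarrow> 0"
    by (rule suminf_exist_split2[OF assms])
  \<comment> \<open>The tail will enter with a factor 2, so \<open>e / 4\<close> leaves
    \<open>e / 2\<close> for the polynomial part, which carries its own factor 2 below.\<close>
  then have "\<forall>\<^sub>F N in sequentially. (\<Sum>n. (b (n + N))\<^sup>2) < e / 4"
    using \<open>0 < e\<close> by (intro order_tendstoD) auto
  then obtain N where N: "(\<Sum>n. (b (n + N))\<^sup>2) < e / 4"
    by (auto simp: eventually_sequentially)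
  have "((\<lambda>r::real. 2 * (1 - r\<^sup>2) * (\<Sum>n<N. b n * r ^ n)\<^sup>2) \<longlongrightarrow>
      2 * (1 - 1\<^sup>2) * (\<Sum>n<N. b n * 1 ^ n)\<^sup>2) (at_left 1)"
    by (intro tendsto_intros)
  then have "\<forall>\<^sub>F r in at_left 1. 2 * (1 - r\<^sup>2) * (\<Sum>n<N. b n * r ^ n)\<^sup>2 < e / 2"
    using \<open>0 < e\<close> by (intro order_tendstoD) auto
  moreover have "\<forall>\<^sub>F r in at_left (1::real). 0 < r \<and> r < 1"
    using eventually_at_left_real[of 0 "1::real"] by (auto elim: eventually_mono)
  ultimately show "\<forall>\<^sub>F r in at_left 1. (1 - r\<^sup>2) * (\<Sum>n. b n * r ^ n)\<^sup>2 < e"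
  proof eventually_elim
    case (elim r)
    define p where "p = (\<Sum>n<N. b n * r ^ n)"
    define t where "t = (\<Sum>n. b (n + N) * r ^ n)"
    have r: "\<bar>r\<bar> < 1" "r\<^sup>2 < 1"
      using elim by (auto simp: abs_square_less_1)
    have sN: "summable (\<lambda>n. (b (n + N))\<^sup>2)"
      using assms by (rule summable_ignore_initial_segment)
    have "(\<Sum>n. b n * r ^ n) = (\<Sum>n. b (n + N) * r ^ (n + N)) + p"
      unfolding p_def using summable_mult_power_of_square_summable[OF assms r(1)]
      by (rule suminf_split_initial_segment)
    also have "(\<Sum>n. b (n + N) * r ^ (n + N)) = r ^ N * t"
      unfolding t_def
      using suminf_mult[OF summable_mult_power_of_square_summable[OF sN r(1)], of "r ^ N"]
      by (simp add: power_add mult_ac)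
    finally have "(\<Sum>n. b n * r ^ n)\<^sup>2 = (r ^ N * t + p)\<^sup>2"
      by simp
    \<comment> \<open>The cross term is absorbed because the square of the difference is
      nonnegative.\<close>
    also have "\<dots> \<le> 2 * (r ^ N * t)\<^sup>2 + 2 * p\<^sup>2"
      using zero_le_power2[of "r ^ N * t - p"] by (simp add: power2_sum power2_diff)
    also have "(r ^ N * t)\<^sup>2 \<le> t\<^sup>2"
      using elim by (auto simp: power_mult_distrib power_le_one mult_left_le_one_le)
    finally have "(1 - r\<^sup>2) * (\<Sum>n. b n * r ^ n)\<^sup>2 \<le> (1 - r\<^sup>2) * (2 * t\<^sup>2 + 2 * p\<^sup>2)"
      using r by (intro mult_left_mono) auto
    also have "\<dots> = 2 * ((1 - r\<^sup>2) * t\<^sup>2) + 2 * (1 - r\<^sup>2) * p\<^sup>2"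
      by (simp add: algebra_simps)
    also have "\<dots> < e"
      using power_series_square_le[OF sN r(1)] N elim by (simp add: t_def p_def)
    finally show ?case .
  qed
next
  fix e :: real assume "e < 0"
  have "\<forall>\<^sub>F r in at_left (1::real). 0 < r \<and> r < 1"
    using eventually_at_left_real[of 0 "1::real"] by (auto elim: eventually_mono)
  then show "\<forall>\<^sub>F r in at_left 1. e < (1 - r\<^sup>2) * (\<Sum>n. b n * r ^ n)\<^sup>2"
  proof eventually_elim
    case (elim r)
    then have "0 \<le> (1 - r\<^sup>2) * (\<Sum>n. b n * r ^ n)\<^sup>2"
      by (simp add: power_le_one)
    with \<open>e < 0\<close> show ?case by linarith
  qed
qed

section \<open>The Frobenius norm and the matrix Hardy space\<close>

text \<open>The norm of a vector of vectors is the Euclidean norm of the row norms, hence the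
  Frobenius norm.\<close>

lemma norm_matrix_square:
  fixes A :: "complex ^ 'n ^ 'm"
  shows "(norm A)\<^sup>2 = (\<Sum>i\<in>UNIV. \<Sum>j\<in>UNIV. (cmod (A $ i $ j))\<^sup>2)"
  by (simp add: norm_vec_def L2_set_def sum_nonneg)

lemma trace_ctranspose_mult_self:
  "trace (ctranspose A ** A) = complex_of_real ((norm A)\<^sup>2)"
proof -
  have "trace (ctranspose A ** A) = (\<Sum>j\<in>UNIV. \<Sum>i\<in>UNIV. complex_of_real ((cmod (A $ i $ j))\<^sup>2))"
    unfolding complex_norm_square
    by (simp add: trace_def ctranspose_def transpose_def map_matrix_def matrix_matrix_mult_def
        mult.commute)
  also have "\<dots> = (\<Sum>i\<in>UNIV. \<Sum>j\<in>UNIV. complex_of_real ((cmod (A $ i $ j))\<^sup>2))"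
    by (rule sum.swap)
  finally show ?thesis
    by (simp add: norm_matrix_square)
qed

lemma norm_map_matrix_mult:
  fixes A :: "complex ^ 'n ^ 'm"
  shows "norm (map_matrix ((*) z) A) = cmod z * norm A"
proof -
  have "(norm (map_matrix ((*) z) A))\<^sup>2 = (cmod z * norm A)\<^sup>2"
    by (simp add: norm_matrix_square norm_mult power_mult_distrib map_matrix_def sum_distrib_left)
  then show ?thesis
    by (simp add: power2_eq_iff_nonneg)
qed

text \<open>Replaces the complex traces by squared norms, so that the scalar lemmas apply to the
  sequence \<open>norm (c n)\<close>.\<close>

lemma hardy2_expansion:
  assumes "F \<in> hardy2"
  obtains c where "\<And>z. cmod z < 1 \<Longrightarrow> (\<lambda>n. map_matrix ((*) (z ^ n)) (c n)) sums F z"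
    and "summable (\<lambda>n. (norm (c n))\<^sup>2)"
proof -
  obtain c where c: "\<forall>z\<in>ball 0 1. (\<lambda>n. map_matrix ((*) (z ^ n)) (c n)) sums F z"
    and s: "summable (\<lambda>n. trace (ctranspose (c n) ** c n))"
    using assms unfolding hardy2_def by blast
  from s have "summable (\<lambda>n. complex_of_real ((norm (c n))\<^sup>2))"
    by (simp only: trace_ctranspose_mult_self)
  then have "summable (\<lambda>n. (norm (c n))\<^sup>2)"
    by (simp only: summable_complex_of_real)
  with c show thesis
    by (intro that[of c]) auto
qed

text \<open>The power series converges uniformly on the smaller disc by the Weierstrass test with
  majorant \<open>norm (c n) * r ^ n\<close>. For negative \<open>r\<close> the disc is
  empty.\<close>

lemma continuous_on_hardy2:
  fixes F :: "complex \<Rightarrow> complex ^ 'q ^ 'p"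
  assumes "F \<in> hardy2" and "r < 1"
  shows "continuous_on (cball 0 r) F"
proof -
  obtain c where c: "\<And>z. cmod z < 1 \<Longrightarrow> (\<lambda>n. map_matrix ((*) (z ^ n)) (c n)) sums F z"
    and s: "summable (\<lambda>n. (norm (c n))\<^sup>2)"
    using hardy2_expansion[OF assms(1)] by blast
  show ?thesis
  proof (cases "0 \<le> r")
    case True
    have "uniform_limit (cball 0 r) (\<lambda>n z. \<Sum>i<n. map_matrix ((*) (z ^ i)) (c i))
        (\<lambda>z. \<Sum>i. map_matrix ((*) (z ^ i)) (c i)) sequentially"
    proof (rule Weierstrass_m_test)
      show "summable (\<lambda>n. norm (c n) * r ^ n)"
        using s assms(2) True by (intro summable_mult_power_of_square_summable) auto
      show "norm (map_matrix ((*) (z ^ n)) (c n)) \<le> norm (c n) * r ^ n" if "z \<in> cball 0 r" for n z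
        using that by (simp add: norm_map_matrix_mult norm_power mult.commute[of _ "norm (c n)"]
            mult_left_mono power_mono)
    qed
    moreover have "continuous_on (cball 0 r) (\<lambda>z. \<Sum>i<n. map_matrix ((*) (z ^ i)) (c i))" for n
      by (simp add: map_matrix_def) (intro continuous_intros)
    ultimately have "continuous_on (cball 0 r) (\<lambda>z. \<Sum>i. map_matrix ((*) (z ^ i)) (c i))"
      by (intro uniform_limit_theorem[where F = sequentially]) auto
    moreover have "F z = (\<Sum>i. map_matrix ((*) (z ^ i)) (c i))" if "z \<in> cball 0 r" for z
      using that assms(2) by (intro sums_unique c) auto
    ultimately show ?thesis
      by (metis (no_types, lifting) continuous_on_cong)
  qed auto
qed

text \<open>The triangle inequality bounds \<open>norm (F w)\<close> by the scalar power series with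
  coefficients \<open>norm (c n)\<close> at the point \<open>cmod w\<close>, which reduces the claim
  to the radial decay.\<close>

lemma hardy2_decay:
  assumes "F \<in> hardy2" and "0 < e"
  obtains r where "r < 1" and "\<And>w. r < cmod w \<Longrightarrow> cmod w < 1 \<Longrightarrow> (1 - (cmod w)\<^sup>2) * (norm (F w))\<^sup>2 < e"
proof -
  obtain c where c: "\<And>z. cmod z < 1 \<Longrightarrow> (\<lambda>n. map_matrix ((*) (z ^ n)) (c n)) sums F z"
    and s: "summable (\<lambda>n. (norm (c n))\<^sup>2)"
    using hardy2_expansion[OF assms(1)] by blast
  have "\<forall>\<^sub>F r in at_left 1. (1 - r\<^sup>2) * (\<Sum>n. norm (c n) * r ^ n)\<^sup>2 < e"
    using power_series_square_decay[OF s] assms(2) by (rule order_tendstoD)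
  then obtain r where r: "r < 1"
    and small: "\<And>x. r < x \<Longrightarrow> x < 1 \<Longrightarrow> (1 - x\<^sup>2) * (\<Sum>n. norm (c n) * x ^ n)\<^sup>2 < e"
    by (auto simp: eventually_at_left_field)
  show thesis
  proof (rule that[OF r])
    fix w assume w: "r < cmod w" "cmod w < 1"
    have "norm (F w) = norm (\<Sum>n. map_matrix ((*) (w ^ n)) (c n))"
      using c[OF w(2)] by (simp add: sums_iff)
    also have "\<dots> \<le> (\<Sum>n. norm (c n) * cmod w ^ n)"
      using summable_norm[of "\<lambda>n. map_matrix ((*) (w ^ n)) (c n)"]
        summable_mult_power_of_square_summable[OF s, of "cmod w"] w
      by (simp add: norm_map_matrix_mult norm_power mult.commute)
    finally have "(norm (F w))\<^sup>2 \<le> (\<Sum>n. norm (c n) * cmod w ^ n)\<^sup>2"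
      by (intro power_mono) auto
    then have "(1 - (cmod w)\<^sup>2) * (norm (F w))\<^sup>2 \<le> (1 - (cmod w)\<^sup>2) * (\<Sum>n. norm (c n) * cmod w ^ n)\<^sup>2"
      using w by (intro mult_left_mono) (auto simp: power_le_one)
    with small[OF w] show "(1 - (cmod w)\<^sup>2) * (norm (F w))\<^sup>2 < e"
      by linarith
  qed
qed

section \<open>Orthogonal projections of fixed rank\<close>

text \<open>Since \<open>P\<close> is idempotent and self-adjoint, the compression is the Gram
  matrix of \<open>P ** A\<close>.\<close>

lemma trace_compression:
  assumes "orthogonal_projection P"
  shows "trace (ctranspose A ** P ** A) = complex_of_real ((norm (P ** A))\<^sup>2)"
proof -
  have "ctranspose A ** P ** A = ctranspose (P ** A) ** (P ** A)"
    using assms unfolding orthogonal_projection_def ctranspose_mult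
    by (metis matrix_mul_assoc)
  then show ?thesis
    by (simp only: trace_ctranspose_mult_self)
qed

lemma matrix_diff_ldistrib:
  fixes A :: "'a::ring_1 ^ 'n ^ 'm"
  shows "A ** (B - C) = A ** B - A ** C"
  by (simp add: vec_eq_iff matrix_matrix_mult_def right_diff_distrib sum_subtractf)

lemma matrix_diff_rdistrib:
  fixes A :: "'a::ring_1 ^ 'n ^ 'm"
  shows "(A - B) ** C = A ** C - B ** C"
  by (simp add: vec_eq_iff matrix_matrix_mult_def left_diff_distrib sum_subtractf)

lemma orthogonal_projection_complement:
  assumes "orthogonal_projection P"
  shows "orthogonal_projection (mat 1 - P)"
proof -
  have "ctranspose (mat 1 - P) = mat 1 - ctranspose P"
    by (simp add: ctranspose_def transpose_def map_matrix_def vec_eq_iff mat_def)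
  moreover have "(mat 1 - P) ** (mat 1 - P) = mat 1 - P - P + P ** P"
    by (simp add: matrix_diff_ldistrib matrix_diff_rdistrib algebra_simps)
  ultimately show ?thesis
    using assms by (simp add: orthogonal_projection_def)
qed

text \<open>Pythagoras: the squared norm of \<open>A\<close> splits into the contributions of
  \<open>P\<close> and of its complement \<open>mat 1 - P\<close>.\<close>

lemma norm_orthogonal_projection_mult_le:
  assumes "orthogonal_projection P"
  shows "norm (P ** A) \<le> norm A"
proof -
  have "ctranspose A ** A = ctranspose A ** P ** A + ctranspose A ** (mat 1 - P) ** A"
    by (simp add: matrix_diff_ldistrib matrix_diff_rdistrib)
  then have "complex_of_real ((norm A)\<^sup>2) =
      complex_of_real ((norm (P ** A))\<^sup>2) + complex_of_real ((norm ((mat 1 - P) ** A))\<^sup>2)"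
    by (metis trace_ctranspose_mult_self trace_add trace_compression assms
        orthogonal_projection_complement)
  then have "(norm A)\<^sup>2 = (norm (P ** A))\<^sup>2 + (norm ((mat 1 - P) ** A))\<^sup>2"
    by (metis of_real_add of_real_eq_iff)
  then have "(norm (P ** A))\<^sup>2 \<le> (norm A)\<^sup>2"
    by simp
  then show ?thesis
    by (rule power2_le_imp_le) simp
qed

text \<open>A crude entrywise bound suffices: it only has to make \<open>x v* A\<close> small
  relative to \<open>x\<close> when \<open>A\<close> is small.\<close>

lemma norm_vector_matrix_mult_le:
  fixes A :: "complex ^ 'n ^ 'm"
  shows "norm (x v* A) \<le> real CARD('n) * real CARD('m) * norm A * norm x"
proof -
  have "norm (x v* A) \<le> (\<Sum>j\<in>UNIV. cmod ((x v* A) $ j))"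
    by (simp add: norm_vec_def L2_set_le_sum)
  also have "\<dots> \<le> (\<Sum>j\<in>(UNIV :: 'n set). \<Sum>i\<in>(UNIV :: 'm set). norm A * norm x)"
  proof (intro sum_mono)
    fix j :: 'n
    have "cmod ((x v* A) $ j) \<le> (\<Sum>i\<in>UNIV. cmod (A $ i $ j * x $ i))"
      by (simp add: vector_matrix_mult_def mult.commute sum_norm_le)
    also have "\<dots> \<le> (\<Sum>i\<in>(UNIV :: 'm set). norm A * norm x)"
      unfolding norm_mult
      by (intro sum_mono mult_mono Finite_Cartesian_Product.norm_nth_le
          order_trans[OF Finite_Cartesian_Product.norm_nth_le Finite_Cartesian_Product.norm_nth_le]) auto
    finally show "cmod ((x v* A) $ j) \<le> (\<Sum>i\<in>(UNIV :: 'm set). norm A * norm x)" .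
  qed
  finally show ?thesis
    by simp
qed

lemma vector_matrix_mult_eq_sum_rows:
  fixes A :: "'a::field ^ 'n ^ 'm"
  shows "x v* A = (\<Sum>i\<in>UNIV. x $ i *s row i A)"
  by (simp add: vec_eq_iff vector_matrix_mult_def row_def mult.commute)

text \<open>Row \<open>i\<close> of \<open>P ** P\<close> is row \<open>i\<close> of
  \<open>P\<close> times \<open>P\<close>, so idempotence fixes each row, and linearity extends this
  to the row space.\<close>

lemma vector_matrix_mult_idempotent:
  fixes P :: "'a::field ^ 'n ^ 'n"
  assumes "P ** P = P" and "x \<in> vec.span (rows P)"
  shows "x v* P = x"
  using assms(2)
proof (induction rule: vec.span_induct_alt)
  case base
  then show ?case
    by simp
next
  case (step k x y)
  then obtain i where x: "x = row i P"
    by (auto simp: rows_def)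
  have "x v* P = row i (P ** P)"
    by (simp add: x vec_eq_iff row_def vector_matrix_mult_def matrix_matrix_mult_def mult.commute)
  then have "x v* P = x"
    using assms(1) x by simp
  then show ?case
    using step by (simp add: vector_matrix_left_distrib scalar_vector_matrix_assoc)
qed

text \<open>The rank is the row rank, and right multiplication by \<open>Q\<close> maps the row space of \<open>P\<close>
  injectively into that of \<open>Q\<close>.\<close>

lemma rank_le_rank_of_near_idempotent:
  fixes P Q :: "complex ^ 'n ^ 'n"
  assumes "P ** P = P" and near: "(real CARD('n))\<^sup>2 * norm (P - Q) < 1"
  shows "rank P \<le> rank Q"
proof -
  have lin: "Vector_Spaces.linear (*s) (*s) (\<lambda>x. x v* Q)"
    by unfold_locales
      (auto simp: vec.scale_right_distrib vec.scale_left_distrib vector_matrix_left_distrib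
        scalar_vector_matrix_assoc)
  \<comment> \<open>On its row space \<open>P\<close> acts as the identity, so a kernel vector of
    \<open>Q\<close> there equals its image under \<open>P - Q\<close>; that map strictly shrinks
    nonzero vectors.\<close>
  have ker: "x = 0" if x: "x \<in> vec.span (rows P)" "x v* Q = 0" for x
  proof (rule ccontr)
    assume "x \<noteq> 0"
    have "x = x v* P - x v* Q"
      using vector_matrix_mult_idempotent[OF assms(1) x(1)] x(2) by simp
    also have "\<dots> = x v* (P - Q)"
      by (simp add: vector_matrix_mult_diff_rdistrib)
    finally have "norm x \<le> (real CARD('n))\<^sup>2 * norm (P - Q) * norm x"
      using norm_vector_matrix_mult_le[of x "P - Q"] by (simp add: power2_eq_square)
    also have "\<dots> < 1 * norm x"
      using near \<open>x \<noteq> 0\<close> by (intro mult_strict_right_mono) auto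
    finally show False
      by simp
  qed
  have "inj_on (\<lambda>x. x v* Q) (vec.span (rows P))"
  proof (rule inj_onI)
    fix x y assume xy: "x \<in> vec.span (rows P)" "y \<in> vec.span (rows P)" "x v* Q = y v* Q"
    with ker[of "x - y"] show "x = y"
      by (simp add: vec.span_diff vector_matrix_mult_diff_distrib)
  qed
  then have "vec.dim (rows P) = vec.dim ((\<lambda>x. x v* Q) ` rows P)"
    using vec.dim_image_eq[OF lin] by simp
  also have "\<dots> \<le> vec.dim (rows Q)"
  proof (rule vec.dim_mono)
    have "x v* Q \<in> vec.span (rows Q)" for x
      unfolding vector_matrix_mult_eq_sum_rows
      by (intro vec.span_sum vec.span_scale vec.span_base) (auto simp: rows_def)
    then show "(\<lambda>x. x v* Q) ` rows P \<subseteq> vec.span (rows Q)"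
      by blast
  qed
  finally show ?thesis
    by (simp add: row_rank_def_gen)
qed

lemma continuous_on_matrix_mult [continuous_intros]:
  fixes f :: "'a::topological_space \<Rightarrow> complex ^ 'n ^ 'm" and g :: "'a \<Rightarrow> complex ^ 'l ^ 'n"
  assumes "continuous_on S f" and "continuous_on S g"
  shows "continuous_on S (\<lambda>x. f x ** g x)"
  unfolding matrix_matrix_mult_def using assms by (intro continuous_intros)

text \<open>Projections are bounded by the norm of the identity and cut out by closed equations; the
  rank survives limits because nearby idempotents have equal rank.\<close>

lemma compact_orthogonal_projections_rank:
  "compact {P :: complex ^ 'p ^ 'p. orthogonal_projection P \<and> rank P = k}" (is "compact ?K")
proof (rule compact_eq_bounded_closed[THEN iffD2, OF conjI])
  show "bounded ?K"
  proof (rule boundedI)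
    fix P assume "P \<in> ?K"
    then show "norm P \<le> norm (mat 1 :: complex ^ 'p ^ 'p)"
      using norm_orthogonal_projection_mult_le[of P "mat 1"] by simp
  qed
  have "continuous_on UNIV (\<lambda>P :: complex ^ 'p ^ 'p. P ** P)"
    by (intro continuous_intros)
  moreover have "continuous_on UNIV (ctranspose :: complex ^ 'p ^ 'p \<Rightarrow> _)"
    unfolding ctranspose_def transpose_def map_matrix_def
    by (simp, intro continuous_intros)
  ultimately have cl: "closed {P :: complex ^ 'p ^ 'p. orthogonal_projection P}"
    unfolding orthogonal_projection_def
    by (intro closed_Collect_conj closed_Collect_eq continuous_on_id)
  show "closed ?K"
    unfolding closed_sequential_limits
  proof (intro allI impI)
    fix X :: "nat \<Rightarrow> complex ^ 'p ^ 'p" and P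
    assume X: "(\<forall>n. X n \<in> ?K) \<and> X \<longlonglongrightarrow> P"
    then have P: "orthogonal_projection P"
      using closed_sequentially[OF cl, of X P] by auto
    have "(\<lambda>n. (real CARD('p))\<^sup>2 * norm (P - X n)) \<longlonglongrightarrow> (real CARD('p))\<^sup>2 * norm (P - P)"
      using X by (intro tendsto_intros) auto
    then have "\<forall>\<^sub>F n in sequentially. (real CARD('p))\<^sup>2 * norm (P - X n) < 1"
      by (rule order_tendstoD) simp
    then obtain n where n: "(real CARD('p))\<^sup>2 * norm (P - X n) < 1"
      by (auto simp: eventually_sequentially)
    \<comment> \<open>The limit and the sequence member are both idempotent, so the comparison of
      ranks applies in either direction.\<close>
    have "rank P \<le> rank (X n)"
      using P n by (intro rank_le_rank_of_near_idempotent) (auto simp: orthogonal_projection_def)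
    moreover have "rank (X n) \<le> rank P"
      using X n by (intro rank_le_rank_of_near_idempotent)
        (auto simp: orthogonal_projection_def norm_minus_commute)
    ultimately show "P \<in> ?K"
      using X P by auto
  qed
qed

lemma exists_orthogonal_projection_rank:
  assumes "k \<le> CARD('p)"
  obtains P :: "complex ^ 'p ^ 'p" where "orthogonal_projection P" and "rank P = k"
proof -
  obtain I :: "'p set" where I: "card I = k"
    using obtain_subset_with_card_n[OF assms] by blast
  \<comment> \<open>The witness is the diagonal projection onto the coordinates in
    \<open>I\<close>.\<close>
  define P :: "complex ^ 'p ^ 'p" where "P = (\<chi> i. if i \<in> I then axis i 1 else 0)"
  have nth: "P $ i $ j = (if i = j \<and> i \<in> I then 1 else 0)" for i j
    by (simp add: P_def axis_def)
  have "orthogonal_projection P"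
    unfolding orthogonal_projection_def
  proof
    show "P ** P = P"
      by (auto simp: vec_eq_iff matrix_matrix_mult_def nth if_distrib[where f = "\<lambda>x. x * _"]
          sum.delta' cong: if_cong intro!: sum.neutral)
    show "ctranspose P = P"
      by (auto simp: vec_eq_iff ctranspose_def transpose_def map_matrix_def nth)
  qed
  moreover have "vec.dim (rows P) = k"
  proof (rule vec.dim_unique)
    have row: "row i P = (if i \<in> I then axis i 1 else 0)" for i
      by (simp add: row_def P_def vec_nth_inverse)
    show "(\<lambda>i. axis i 1) ` I \<subseteq> rows P"
      using row by (force simp: rows_def)
    show "rows P \<subseteq> vec.span ((\<lambda>i. axis i 1) ` I)"
      by (auto simp: rows_def row intro: vec.span_base vec.span_zero)
    show "vec.independent ((\<lambda>i. axis i (1::complex)) ` I)"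
      by (rule vec.independent_mono[OF independent_cart_basis]) (auto simp: cart_basis_def)
    show "card ((\<lambda>i. axis i (1::complex)) ` I) = k"
      by (subst card_image) (auto simp: I inj_on_def axis_eq_axis)
  qed
  ultimately show thesis
    by (intro that) (simp_all add: row_rank_def_gen)
qed

section \<open>Existence of the maximum\<close>

text \<open>The rank condition is hidden in the compact set \<open>K\<close>, which leaves a
  maximisation over the open disc times \<open>K\<close>.\<close>

lemma hardy2_projection_max:
  fixes F :: "complex \<Rightarrow> complex ^ 'q ^ 'p"
  assumes "F \<in> hardy2" and K: "compact K" "K \<noteq> {}" "\<And>P. P \<in> K \<Longrightarrow> orthogonal_projection P"
  obtains w0 P0 where "w0 \<in> ball 0 1" and "P0 \<in> K"
    and "\<And>w P. w \<in> ball 0 1 \<Longrightarrow> P \<in> K \<Longrightarrow>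
      (1 - (cmod w)\<^sup>2) * (norm (P ** F w))\<^sup>2 \<le> (1 - (cmod w0)\<^sup>2) * (norm (P0 ** F w0))\<^sup>2"
proof -
  define V where "V w P = (1 - (cmod w)\<^sup>2) * (norm (P ** F w))\<^sup>2" for w and P :: "complex ^ 'p ^ 'p"
  show thesis
  \<comment> \<open>A positive value of \<open>V\<close> serves as the threshold in the boundary
    decay; without one the maximum is trivial.\<close>
  proof (cases "\<exists>w P. w \<in> ball 0 1 \<and> P \<in> K \<and> 0 < V w P")
    case True
    then obtain w1 P1 where 1: "cmod w1 < 1" "P1 \<in> K" "0 < V w1 P1"
      by auto
    obtain r where r: "r < 1"
      and small: "\<And>w. r < cmod w \<Longrightarrow> cmod w < 1 \<Longrightarrow> (1 - (cmod w)\<^sup>2) * (norm (F w))\<^sup>2 < V w1 P1"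
      using hardy2_decay[OF assms(1) 1(3)] by blast
    \<comment> \<open>The disc of radius \<open>s\<close> must contain \<open>w1\<close>, so that
      the maximum over it is at least the threshold \<open>V w1 P1\<close>. This also makes the
      radius nonnegative, which is not known of \<open>r\<close>.\<close>
    define s where "s = max r (cmod w1)"
    have s: "s < 1" "r \<le> s" "cmod w1 \<le> s" "0 \<le> s"
      using r 1 by (auto simp: s_def intro: max.coboundedI2)
    have "continuous_on (cball 0 s \<times> K) (\<lambda>x. F (fst x))"
      by (intro continuous_on_compose2[OF continuous_on_hardy2[OF assms(1) s(1)]]
          continuous_intros) auto
    then have "continuous_on (cball 0 s \<times> K) (\<lambda>x. V (fst x) (snd x))"
      unfolding V_def by (intro continuous_intros)
    moreover have "compact (cball (0::complex) s \<times> K)"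
      by (intro compact_Times compact_cball K)
    ultimately have "\<exists>x\<in>cball 0 s \<times> K. \<forall>y\<in>cball 0 s \<times> K. V (fst y) (snd y) \<le> V (fst x) (snd x)"
      using 1 s by (intro continuous_attains_sup) auto
    then obtain w0 P0 where 0: "cmod w0 \<le> s" "P0 \<in> K"
      and max: "\<And>w P. cmod w \<le> s \<Longrightarrow> P \<in> K \<Longrightarrow> V w P \<le> V w0 P0"
      by fastforce
    show thesis
    proof (rule that)
      show "w0 \<in> ball 0 1" "P0 \<in> K"
        using 0 s by auto
      fix w :: complex and P :: "complex ^ 'p ^ 'p"
      assume w: "w \<in> ball 0 1" "P \<in> K"
      have "V w P \<le> V w0 P0"
      proof (cases "cmod w \<le> s")
        case False
        \<comment> \<open>Discarding the projection gives a bound independent of \<open>P\<close>,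
          to which the decay near the circle applies.\<close>
        have "V w P \<le> (1 - (cmod w)\<^sup>2) * (norm (F w))\<^sup>2"
          unfolding V_def using w K(3)
          by (intro mult_left_mono power_mono norm_orthogonal_projection_mult_le)
            (auto simp: power_le_one)
        also have "\<dots> < V w1 P1"
          using False s w by (intro small) auto
        also have "\<dots> \<le> V w0 P0"
          using max 1 s by blast
        finally show ?thesis
          by simp
      qed (use max w in auto)
      then show "(1 - (cmod w)\<^sup>2) * (norm (P ** F w))\<^sup>2 \<le> (1 - (cmod w0)\<^sup>2) * (norm (P0 ** F w0))\<^sup>2"
        by (simp add: V_def)
    qed
  next
    case False
    obtain P0 where "P0 \<in> K"
      using K(2) by blast
    show thesis
    \<comment> \<open>No value is positive and the value at the origin is nonnegative, so the origin
      with any member of \<open>K\<close> is a maximiser.\<close>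
    proof (rule that[of 0 P0])
      fix w :: complex and P :: "complex ^ 'p ^ 'p"
      assume "w \<in> ball 0 1" "P \<in> K"
      then have "V w P \<le> 0"
        using False by (meson not_less)
      also have "0 \<le> V 0 P0"
        by (simp add: V_def)
      finally show "(1 - (cmod w)\<^sup>2) * (norm (P ** F w))\<^sup>2 \<le> (1 - (cmod 0)\<^sup>2) * (norm (P0 ** F 0))\<^sup>2"
        by (simp add: V_def)
    qed (use \<open>P0 \<in> K\<close> in auto)
  qed
qed

theorem proposition2p1:
  fixes F :: "complex \<Rightarrow> complex ^ 'q ^ 'p" and k0 :: nat
  assumes "1 \<le> k0" and "k0 \<le> CARD('p)"
    and "F \<in> hardy2"
  shows "\<exists>w0 P0. w0 \<in> ball 0 1 \<and> orthogonal_projection P0 \<and> rank P0 = k0 \<and>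
    complex_of_real (1 - (cmod w0)\<^sup>2) * trace (mat_form (P0 ** F w0) (F w0)) =
      complex_of_real (1 - (cmod w0)\<^sup>2) * trace (ctranspose (F w0) ** P0 ** F w0) \<and>
    (\<forall>w P. w \<in> ball 0 1 \<and> orthogonal_projection P \<and> rank P = k0 \<longrightarrow>
      (1 - (cmod w)\<^sup>2) * Re (trace (ctranspose (F w) ** P ** F w)) \<le>
      (1 - (cmod w0)\<^sup>2) * Re (trace (ctranspose (F w0) ** P0 ** F w0)))"
proof -
  let ?K = "{P :: complex ^ 'p ^ 'p. orthogonal_projection P \<and> rank P = k0}"
  have "?K \<noteq> {}"
    using exists_orthogonal_projection_rank[OF assms(2)] by blast
  then obtain w0 :: complex and P0 where 0: "w0 \<in> ball 0 1" "P0 \<in> ?K"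
    and max: "\<And>w P. w \<in> ball 0 1 \<Longrightarrow> P \<in> ?K \<Longrightarrow>
      (1 - (cmod w)\<^sup>2) * (norm (P ** F w))\<^sup>2 \<le> (1 - (cmod w0)\<^sup>2) * (norm (P0 ** F w0))\<^sup>2"
    using hardy2_projection_max[OF assms(3) compact_orthogonal_projections_rank[of k0]] by blast
  show ?thesis
  proof (intro exI[of _ w0] exI[of _ P0] conjI allI impI)
    show "complex_of_real (1 - (cmod w0)\<^sup>2) * trace (mat_form (P0 ** F w0) (F w0)) =
      complex_of_real (1 - (cmod w0)\<^sup>2) * trace (ctranspose (F w0) ** P0 ** F w0)"
      by (simp add: mat_form_def matrix_mul_assoc)
    fix w :: complex and P :: "complex ^ 'p ^ 'p"
    assume wP: "w \<in> ball 0 1 \<and> orthogonal_projection P \<and> rank P = k0"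
    \<comment> \<open>Both traces are squared Frobenius norms of projected values, which is the form
      already maximised.\<close>
    with 0 max[of w P] show "(1 - (cmod w)\<^sup>2) * Re (trace (ctranspose (F w) ** P ** F w)) \<le>
      (1 - (cmod w0)\<^sup>2) * Re (trace (ctranspose (F w0) ** P0 ** F w0))"
      by (simp add: trace_compression)
  qed (use 0 in auto)
qed

end
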